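(* Let $m,n\ge1$ and $d=m+n$. For any $A\in M_{m\times n}(\mathbb{R})$ such that $Ap_2(\mathbf{v})\ne p_1(\mathbf{v})$ for all $\mathbf{v}\in\mathbb{Z}^d\setminus\{0\}$, $$\beta(x_A)=\frac{n}{d}+\gamma(x_A)=1-\frac{1}{\mu(A)}.$$
   Context: Write $\mathbb{R}^d=\mathbb{R}^m\times\mathbb{R}^n$ with projections $p_1,p_2$. Let $\|\mathbf{v}\|=\max(\|p_1(\mathbf{v})\|_2,\|p_2(\mathbf{v})\|_2)$, where $\|\cdot\|_2$ is the Euclidean norm (also used for matrices). Let $X_d=SL(d,\mathbb{R})/SL(d,\mathbb{Z})$, and for $x=g\,SL(d,\mathbb{Z})$ let $\Lambda_x=g\mathbb{Z}^d_{prim}$, where $\mathbb{Z}^d_{prim}$ is the set of non-zero primitive integer vectors, and $\alpha_1(x)=\sup_{\mathbf{v}\in\Lambda_x}1/\|\mathbf{v}\|$. Let $$g_t=\begin{pmatrix}e^{nt/d}I_m&0\\0&e^{-mt/d}I_n\end{pmatrix},\qquad h_B=\begin{pmatrix}I_m&0\\ B&I_n\end{pmatrix}\ (B\in M_{n\times m}(\mathbb{R})),\qquad \mathcal{B}_s=\{h_B:\|B\|_2\le s\},$$ $$\beta(x)=\limsup_{s\to\infty}\frac{\sup_{h\in\mathcal{B}_s}\log\alpha_1(hx)}{\log s},\qquad \gamma(x)=\limsup_{t\to\infty}\frac{\log\alpha_1(g_tx)}{t}.$$ For $A\in M_{m\times n}(\mathbb{R})$ let $x_A=\begin{pmatrix}I_m&-A\\0&I_n\end{pmatrix}SL(d,\mathbb{Z})\in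 X_d$. The Diophantine exponent $\mu(A)\in\mathbb{R}\cup\{+\infty\}$ is the supremum of the set of $\nu>0$ such that there are infinitely many $\mathbf{v}\in\mathbb{Z}^d$ with $p_2(\mathbf{v})\ne0$ and $\|Ap_2(\mathbf{v})-p_1(\mathbf{v})\|_2\le\|p_2(\mathbf{v})\|_2^{-(\nu-1)}$ (with $1/\infty=0$). *)

theory Defs
  imports "HOL-Analysis.Analysis"
begin

text \<open>
  Coordinates of \<open>\<real>\<^sup>d = \<real>\<^sup>m \<times> \<real>\<^sup>n\<close> are indexed by the sum type \<open>'m + 'n\<close>, so that
  \<open>m = CARD('m)\<close>, \<open>n = CARD('n)\<close> and \<open>d = m + n\<close>; an \<open>a \<times> b\<close> matrix has type \<open>real^'b^'a\<close>.
  On \<open>real^'b^'a\<close> the library's \<open>norm\<close> is the square root of the sum of the squared entries.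
\<close>

definition p1 :: "real^('m::finite + 'n::finite) \<Rightarrow> real^'m" where
  "p1 v = (\<chi> i. v $ Inl i)"

definition p2 :: "real^('m::finite + 'n::finite) \<Rightarrow> real^'n" where
  "p2 v = (\<chi> j. v $ Inr j)"

definition mnorm :: "real^('m::finite + 'n::finite) \<Rightarrow> real" where
  "mnorm v = max (norm (p1 v)) (norm (p2 v))"

definition block ::
  "real^'m^'m \<Rightarrow> real^'n^'m \<Rightarrow> real^'m^'n \<Rightarrow> real^'n^'n \<Rightarrow>
    real^('m::finite + 'n::finite)^('m + 'n)" where
  "block P Q R S = (\<chi> i j.
     case i of
       Inl a \<Rightarrow> (case j of Inl b \<Rightarrow> P $ a $ b | Inr b \<Rightarrow> Q $ a $ b)
     | Inr a \<Rightarrow> (case j of Inl b \<Rightarrow> R $ a $ b | Inr b \<Rightarrow> S $ a $ b))"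

definition int_vecs :: "(real^'k) set" where
  "int_vecs = {v. \<forall>i. v $ i \<in> \<int>}"

definition prim_vecs :: "(real^'k) set" where
  "prim_vecs = {(\<chi> i. of_int (z $ i)) | z :: int^'k. z \<noteq> 0 \<and> Gcd (range (\<lambda>i. z $ i)) = 1}"

definition SL_R :: "(real^'k::finite^'k) set" where
  "SL_R = {g. det g = 1}"

definition SL_Z :: "(real^'k::finite^'k) set" where
  "SL_Z = {g. det g = 1 \<and> (\<forall>i j. g $ i $ j \<in> \<int>)}"

definition SL_coset :: "real^'k::finite^'k \<Rightarrow> (real^'k^'k) set" where
  "SL_coset g = (\<lambda>u. g ** u) ` SL_Z"

definition X_space :: "(real^'k::finite^'k) set set" where
  "X_space = SL_coset ` SL_R"

definition act :: "real^'k::finite^'k \<Rightarrow> (real^'k^'k) set \<Rightarrow> (real^'k^'k) set" where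
  "act h x = (\<lambda>g. h ** g) ` x"

text \<open>
  The union over all representatives \<open>g\<close> of \<open>x\<close>; every representative gives the same set,
  see \<open>Lam_SL_coset\<close> below.
\<close>

definition Lam :: "(real^'k::finite^'k) set \<Rightarrow> (real^'k) set" where
  "Lam x = (\<Union>g\<in>x. (\<lambda>z. g *v z) ` prim_vecs)"

definition alpha1 :: "(real^('m::finite + 'n::finite)^('m + 'n)) set \<Rightarrow> real" where
  "alpha1 x = (SUP v\<in>Lam x. 1 / mnorm v)"

definition g_flow :: "real \<Rightarrow> real^('m::finite + 'n::finite)^('m + 'n)" where
  "g_flow t =
    block (mat (exp (real CARD('n) * t / real (CARD('m) + CARD('n))))) 0
          0 (mat (exp (- (real CARD('m) * t / real (CARD('m) + CARD('n))))))"

definition h_mat :: "real^'m^'n \<Rightarrow> real^('m::finite + 'n::finite)^('m + 'n)" where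
  "h_mat B = block (mat 1) 0 B (mat 1)"

definition h_ball :: "real \<Rightarrow> (real^('m::finite + 'n::finite)^('m + 'n)) set" where
  "h_ball s = {h_mat B | B. norm B \<le> s}"

definition beta :: "(real^('m::finite + 'n::finite)^('m + 'n)) set \<Rightarrow> ereal" where
  "beta x = Limsup at_top
     (\<lambda>s::real. (SUP h\<in>h_ball s. ereal (ln (alpha1 (act h x)))) / ereal (ln s))"

definition gamma :: "(real^('m::finite + 'n::finite)^('m + 'n)) set \<Rightarrow> ereal" where
  "gamma x = Limsup at_top (\<lambda>t::real. ereal (ln (alpha1 (act (g_flow t) x)) / t))"

definition x_pt :: "real^'n^'m \<Rightarrow> (real^('m::finite + 'n::finite)^('m + 'n)) set" where
  "x_pt A = SL_coset (block (mat 1) (- A) 0 (mat 1))"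

definition mu :: "real^'n::finite^'m::finite \<Rightarrow> ereal" where
  "mu A = Sup (ereal ` {\<nu>. \<nu> > 0 \<and>
     infinite {v :: real^('m + 'n). v \<in> int_vecs \<and> p2 v \<noteq> 0 \<and>
       norm (A *v p2 v - p1 v) \<le> norm (p2 v) powr (- (\<nu> - 1))}})"

lemma det_Ints:
  fixes g :: "real^'k::finite^'k"
  assumes "\<And>i j. g $ i $ j \<in> \<int>"
  shows "det g \<in> \<int>"
  unfolding det_def using assms by (intro Ints_sum Ints_mult Ints_prod) auto

lemma SL_Z_int_vecs_cancel:
  fixes u :: "real^'k::finite^'k"
  assumes u: "u \<in> SL_Z" and b: "u *v x \<in> int_vecs"
  shows "x \<in> int_vecs"
proof -
  have d: "det u = 1" and ui: "\<And>i j. u $ i $ j \<in> \<int>" using u by (auto simp: SL_Z_def)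
  have x: "x = (\<chi> k. det (\<chi> i j. if j = k then (u *v x) $ i else u $ i $ j) / det u)"
    using cramer[of u x "u *v x"] d by simp
  have "det (\<chi> i j. if j = k then (u *v x) $ i else u $ i $ j) \<in> \<int>" for k
    by (rule det_Ints) (use ui b in \<open>auto simp: int_vecs_def\<close>)
  then show ?thesis
    by (subst x) (simp add: int_vecs_def d)
qed

lemma SL_Z_prim_vecs:
  fixes u :: "real^'k::finite^'k"
  assumes u: "u \<in> SL_Z" and v: "v \<in> prim_vecs"
  shows "u *v v \<in> prim_vecs"
proof -
  obtain z :: "int^'k" where vz: "v = (\<chi> i. of_int (z $ i))" and z0: "z \<noteq> 0"
    and gz: "Gcd (range (\<lambda>i. z $ i)) = 1"
    using v by (auto simp: prim_vecs_def)
  have d: "det u = 1" and ui: "\<And>i j. u $ i $ j \<in> \<int>" using u by (auto simp: SL_Z_def)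
  have "(u *v v) $ i \<in> \<int>" for i
    unfolding matrix_vector_mult_def vz using ui by (auto intro!: Ints_sum Ints_mult)
  then have "\<forall>i. \<exists>w. (u *v v) $ i = of_int w" by (auto simp: Ints_def)
  then obtain w where w: "\<And>i. (u *v v) $ i = of_int (w i)" by metis
  let ?y = "(\<chi> i. w i) :: int^'k"
  have uv: "u *v v = (\<chi> i. of_int (?y $ i))" by (simp add: vec_eq_iff w)
  define k where "k = Gcd (range (\<lambda>i. ?y $ i))"
  have v0: "v \<noteq> 0" using z0 by (auto simp: vz vec_eq_iff)
  have uv0: "u *v v \<noteq> 0"
  proof
    assume "u *v v = 0"
    then have "u *v v = u *v 0" by simp
    moreover obtain u' where "u' ** u = mat 1" using d
      by (metis invertible_det_nz invertible_left_inverse zero_neq_one)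
    ultimately show False using v0
      by (metis matrix_vector_mul_assoc matrix_vector_mul_lid)
  qed
  then have y0: "?y \<noteq> 0" unfolding uv by (auto simp: vec_eq_iff)
  then have k0: "k \<noteq> 0" unfolding k_def by (auto simp: Gcd_0_iff vec_eq_iff)
  have kw: "k dvd w i" for i unfolding k_def by (rule Gcd_dvd) auto
  have "u *v ((1 / of_int k) *\<^sub>R v) = (1 / of_int k) *\<^sub>R (u *v v)"
    by (simp add: matrix_vector_mult_scaleR)
  also have "\<dots> \<in> int_vecs"
    unfolding int_vecs_def
  proof (intro CollectI allI)
    fix i
    obtain q where "w i = k * q" using kw[of i] by (auto simp: dvd_def)
    then show "((1 / of_int k) *\<^sub>R (u *v v)) $ i \<in> \<int>" using k0 by (simp add: w)
  qed
  finally have "(1 / of_int k) *\<^sub>R v \<in> int_vecs" by (rule SL_Z_int_vecs_cancel[OF u])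
  then have *: "of_int (z $ i) / of_int k \<in> (\<int> :: real set)" for i by (auto simp: int_vecs_def vz)
  have "k dvd z $ i" for i
  proof -
    obtain q where "of_int (z $ i) / of_int k = (of_int q :: real)" using *[of i] by (auto simp: Ints_def)
    then have "(of_int (z $ i) :: real) = of_int (k * q)" using k0 by (simp add: field_simps)
    then show ?thesis by (metis dvd_triv_left of_int_eq_iff)
  qed
  then have "k dvd Gcd (range (\<lambda>i. z $ i))" by (auto intro: Gcd_greatest)
  moreover have "k \<ge> 0" by (simp add: k_def)
  ultimately have "k = 1" using gz by auto
  then have "Gcd (range (\<lambda>i. ?y $ i)) = 1" by (simp only: k_def)
  with uv y0 show ?thesis
    unfolding prim_vecs_def by (intro CollectI exI[of _ ?y] conjI)
qed

lemma mat_1_SL_Z: "mat 1 \<in> SL_Z"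
  by (simp add: SL_Z_def) (simp add: mat_def)

lemma Lam_SL_coset: "Lam (SL_coset g) = (\<lambda>z. g *v z) ` prim_vecs"
proof
  show "Lam (SL_coset g) \<subseteq> (\<lambda>z. g *v z) ` prim_vecs"
    using SL_Z_prim_vecs by (fastforce simp: Lam_def SL_coset_def matrix_vector_mul_assoc[symmetric])
  have "g \<in> SL_coset g" unfolding SL_coset_def using mat_1_SL_Z by (force intro: rev_image_eqI)
  then show "(\<lambda>z. g *v z) ` prim_vecs \<subseteq> Lam (SL_coset g)" by (auto simp: Lam_def)
qed

lemma act_SL_coset: "act h (SL_coset g) = SL_coset (h ** g)"
  by (simp add: act_def SL_coset_def image_image matrix_mul_assoc)

text \<open>On \<open>X_space\<close> the real supremum in \<open>alpha1\<close> is over a non-empty bounded set.\<close>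

lemma prim_vecs_norm_ge:
  assumes "z \<in> prim_vecs" shows "norm z \<ge> 1"
proof -
  obtain w :: "int^'a" where z: "z = (\<chi> i. of_int (w $ i))" and "w \<noteq> 0"
    using assms by (auto simp: prim_vecs_def)
  then obtain i where "w $ i \<noteq> 0" by (auto simp: vec_eq_iff)
  then have "1 \<le> \<bar>z $ i\<bar>" by (simp add: z)
  then show ?thesis using component_le_norm_cart[of z i] by linarith
qed

lemma norm_le_mnorm: "norm v \<le> 2 * mnorm v"
proof -
  have "(norm v)\<^sup>2 = (norm (p1 v))\<^sup>2 + (norm (p2 v))\<^sup>2"
    unfolding power2_norm_eq_inner inner_vec_def p1_def p2_def
    by (simp add: UNIV_Plus_UNIV[symmetric] sum.Plus del: UNIV_Plus_UNIV)
  also have "\<dots> \<le> (norm (p1 v) + norm (p2 v))\<^sup>2" by (simp add: power2_sum)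
  finally have "norm v \<le> norm (p1 v) + norm (p2 v)" by (rule power2_le_imp_le) simp
  then show ?thesis by (auto simp: mnorm_def)
qed

lemma alpha1_wf:
  fixes x :: "(real^('m::finite + 'n::finite)^('m + 'n)) set"
  assumes "x \<in> X_space"
  shows "Lam x \<noteq> {}" "bdd_above ((\<lambda>v. 1 / mnorm v) ` Lam x)"
proof -
  obtain g where x: "x = SL_coset g" and g: "det g = 1" using assms by (auto simp: X_space_def SL_R_def)
  have "(\<chi> i. of_int ((\<chi> i. 1 :: int^('m + 'n)) $ i)) \<in> (prim_vecs :: (real^('m + 'n)) set)" 
    unfolding prim_vecs_def by (rule CollectI, rule exI[of _ "\<chi> i. 1"]) (auto simp: vec_eq_iff)
  then show "Lam x \<noteq> {}" by (auto simp: x Lam_SL_coset)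
  obtain g' where g': "g' ** g = mat 1" using g
    by (metis invertible_det_nz invertible_left_inverse zero_neq_one)
  obtain K where K: "K > 0" "\<And>v. norm (g' *v v) \<le> norm v * K"
    using bounded_linear.pos_bounded[OF matrix_vector_mul_bounded_linear[of g']] by blast
  have "1 / mnorm (g *v z) \<le> 2 * K" if "z \<in> prim_vecs" for z
  proof -
    have "1 \<le> norm (g' *v (g *v z))"
      using prim_vecs_norm_ge[OF that] by (simp add: matrix_vector_mul_assoc g')
    also have "\<dots> \<le> norm (g *v z) * K" by (rule K)
    also have "\<dots> \<le> 2 * mnorm (g *v z) * K" using norm_le_mnorm K by (intro mult_right_mono) auto
    finally have "1 \<le> 2 * K * mnorm (g *v z)" by (simp add: mult_ac)
    moreover from this have "mnorm (g *v z) > 0" using K(1)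
      by (smt (verit) mult_nonneg_nonpos)
    ultimately show ?thesis by (simp add: field_simps)
  qed
  then show "bdd_above ((\<lambda>v. 1 / mnorm v) ` Lam x)"
    by (auto simp: x Lam_SL_coset intro!: bdd_aboveI[of _ "2 * K"])
qed

lemma block_mult:
  "block P Q R S ** block P' Q' R' S' =
    block (P ** P' + Q ** R') (P ** Q' + Q ** S') (R ** P' + S ** R') (R ** Q' + S ** S')"
  by (simp add: vec_eq_iff matrix_matrix_mult_def block_def UNIV_Plus_UNIV[symmetric] sum.Plus
      split: sum.split del: UNIV_Plus_UNIV)

lemma block_1: "block (mat 1) 0 0 (mat 1) = mat 1"
  by (auto simp: vec_eq_iff block_def mat_def split: sum.split)

lemma det_block_mat:
  "det (block (mat a :: real^'m::finite^'m) 0 0 (mat b :: real^'n::finite^'n)) =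
    a ^ CARD('m) * b ^ CARD('n)"
proof -
  have "det (block (mat a :: real^'m^'m) 0 0 (mat b :: real^'n^'n)) =
      (\<Prod>i\<in>UNIV. block (mat a :: real^'m^'m) 0 0 (mat b :: real^'n^'n) $ i $ i)"
    by (rule det_diagonal) (auto simp: block_def mat_def split: sum.split)
  also have "\<dots> = a ^ CARD('m) * b ^ CARD('n)"
    by (simp add: UNIV_Plus_UNIV[symmetric] prod.Plus block_def mat_def del: UNIV_Plus_UNIV)
  finally show ?thesis .
qed

lemma mat_scale: "mat a ** (Q :: real^'n::finite^'m::finite) = a *\<^sub>R Q"
  "Q ** mat a = a *\<^sub>R Q"
  by (auto simp: vec_eq_iff matrix_matrix_mult_def mat_def if_distrib[of "\<lambda>x. x * _"]
      if_distrib[of "\<lambda>x. _ * x"] mult.commute cong: if_cong)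

lemma mat_2: "2 * mat 1 = (mat 2 :: real^'n::finite^'n)"
  by (simp add: vec_eq_iff mat_def)

text \<open>
  Conjugating a block unipotent \<open>U\<close> by a diagonal matrix gives \<open>U ** U\<close>, so \<open>det U = (det U)\<^sup>2\<close>.
\<close>

lemma det_unipotent:
  fixes Q :: "real^'n::finite^'m::finite" and R :: "real^'m^'n"
  shows "det (block (mat 1) Q 0 (mat 1)) = 1" "det (block (mat 1) 0 R (mat 1)) = 1"
proof -
  have *: "det U = 1" if "U ** D = D ** (U ** U)" "U ** V = mat 1" "det D \<noteq> 0"
    for U V D :: "real^('m + 'n)^('m + 'n)"
  proof -
    have "det U * det D = det D * (det U * det U)" using that(1) by (metis det_mul)
    moreover have "det U * det V = 1" using that(2) by (metis det_mul det_I)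
    then have "det U \<noteq> 0" by auto
    ultimately show ?thesis using that(3) by simp
  qed
  let ?D = "\<lambda>a b. block (mat a :: real^'m^'m) 0 0 (mat b :: real^'n^'n)"
  show "det (block (mat 1) Q 0 (mat 1)) = 1"
    by (rule *[of _ "?D 1 2" "block (mat 1) (- Q) 0 (mat 1)"])
      (simp_all add: block_mult mat_scale det_block_mat block_1 scaleR_2 mat_2)
  show "det (block (mat 1) 0 R (mat 1)) = 1"
    by (rule *[of _ "?D 2 1" "block (mat 1) 0 (- R) (mat 1)"])
      (simp_all add: block_mult mat_scale det_block_mat block_1 scaleR_2 mat_2)
qed

lemma x_pt_in_X_space: "x_pt A \<in> X_space"
  by (simp add: x_pt_def X_space_def SL_R_def det_unipotent)

lemma h_ball_SL_R: "h_ball s \<subseteq> SL_R"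
  by (auto simp: h_ball_def h_mat_def SL_R_def det_unipotent)

lemma g_flow_SL_R: "g_flow t \<in> SL_R"
proof -
  have "exp x ^ k * exp y ^ l = exp (real k * x + real l * y)" for x y :: real and k l
    by (simp add: exp_of_nat_mult exp_add)
  then show ?thesis
    unfolding g_flow_def SL_R_def mem_Collect_eq det_block_mat by simp
qed

lemma act_X_space: "h \<in> SL_R \<Longrightarrow> x \<in> X_space \<Longrightarrow> act h x \<in> X_space"
  by (auto simp: X_space_def SL_R_def act_SL_coset det_mul)

end

theory Submission
  imports Defs "HOL-Real_Asymp.Real_Asymp"
begin

text \<open>
  For an integer vector \<open>v\<close> write \<open>a = \<parallel>A (p\<^sub>2 v) - p\<^sub>1 v\<parallel>\<close> and \<open>b = \<parallel>p\<^sub>2 v\<parallel>\<close>; by hypothesis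
  \<open>a > 0\<close> unless \<open>v = 0\<close>. Both exponents measure the growth in \<open>T\<close> of
  \<open>F T = sup 1 / max a (b / T)\<close>, the supremum being over primitive \<open>v\<close>.

  The flow \<open>g\<^sub>t\<close> multiplies \<open>a\<close> by \<open>exp (n t / d)\<close> and \<open>b\<close> by \<open>exp (n t / d) / exp t\<close>, so
  \<open>\<alpha>\<^sub>1\<close> at time \<open>t\<close> is exactly \<open>exp (- n t / d) * F (exp t)\<close>, which explains the summand \<open>n / d\<close>.
  A matrix \<open>B\<close> of norm at most \<open>s\<close> moves the second component of the lattice vector by at most
  \<open>s a\<close>, hence leaves its norm at least \<open>max a (b / (s + 1))\<close>; and if \<open>s = b / a\<close>, a rank-one
  \<open>B\<close> of norm \<open>s\<close> kills the second component and the norm becomes exactly \<open>a\<close>. So the supremum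
  over the ball of radius \<open>s\<close> is at most \<open>F (s + 1)\<close>, and it is at least \<open>1 / a\<close> if \<open>s = b / a\<close>.
  Likewise \<open>F (b / a) \<ge> 1 / a\<close>, and these lower bounds suffice.

  It remains to compare with \<open>\<mu>\<close>. Put \<open>\<kappa> = 1 - 1 / \<nu>\<close>. If \<open>b > 0\<close>, the inequality
  \<open>a \<le> b powr (1 - \<nu>)\<close> says precisely that \<open>1 / a \<ge> (b / a) powr \<kappa>\<close>. If \<open>\<nu> < \<mu>\<close>, infinitely many
  solutions give arbitrarily large \<open>T = b / a\<close> with \<open>1 / a \<ge> T powr \<kappa>\<close> (\<open>mu_lower\<close>; dividing \<open>v\<close>
  by the greatest common divisor of its entries does not change \<open>b / a\<close> and does not increase \<open>a\<close>).
  If \<open>\<nu> > \<mu>\<close>, then \<open>\<nu> > 1\<close> by \<open>mu_ge_1\<close>, and all but finitely many \<open>v\<close> with \<open>b > 0\<close> violate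
  the inequality; for these \<open>1 / max a (b / T) \<le> T powr \<kappa>\<close> for all \<open>T \<ge> 1\<close>, because of \<open>a\<close> if
  \<open>b \<le> T powr (1 / \<nu>)\<close> and because of \<open>b / T\<close> otherwise. The remaining \<open>v\<close> contribute a bounded
  amount (\<open>mu_upper\<close>).
\<close>

section \<open>Integer vectors, primitive vectors and the matrix norm\<close>

lemma int_vecs_component_abs_ge_1:
  assumes "v \<in> int_vecs" "v $ i \<noteq> 0"
  shows "1 \<le> \<bar>v $ i\<bar>"
  using assms by (auto simp: int_vecs_def intro: Ints_nonzero_abs_ge1)

lemma int_vecs_norm_ge_1:
  fixes v :: "real^'k::finite"
  assumes "v \<in> int_vecs" "v \<noteq> 0"
  shows "1 \<le> norm v"
proof -
  obtain i where "v $ i \<noteq> 0" using assms(2) by (auto simp: vec_eq_iff)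
  then show ?thesis
    using int_vecs_component_abs_ge_1[OF assms(1)] component_le_norm_cart[of v i] by fastforce
qed

lemma int_vecs_p1: "v \<in> int_vecs \<Longrightarrow> p1 v \<in> int_vecs"
  and int_vecs_p2: "v \<in> int_vecs \<Longrightarrow> p2 v \<in> int_vecs"
  by (auto simp: int_vecs_def p1_def p2_def)

lemma p1_eq_0_p2_eq_0: "p1 v = 0 \<Longrightarrow> p2 v = 0 \<Longrightarrow> v = 0"
  by (simp add: vec_eq_iff p1_def p2_def) (metis obj_sumE)

lemma p2_zero [simp]: "p2 0 = 0"
  by (simp add: vec_eq_iff p2_def)

lemma p1_scaleR: "p1 (c *\<^sub>R v) = c *\<^sub>R p1 v"
  and p2_scaleR: "p2 (c *\<^sub>R v) = c *\<^sub>R p2 v"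
  by (auto simp: vec_eq_iff p1_def p2_def)

lemma finite_int_vecs_norm_le: "finite {v :: real^'k::finite. v \<in> int_vecs \<and> norm v \<le> R}"
proof -
  let ?I = "{x \<in> \<int>. \<bar>x\<bar> \<le> R}"
  have "finite (vec_nth -` (UNIV \<rightarrow>\<^sub>E ?I) :: (real^'k) set)"
    by (rule finite_vimageI[OF finite_PiE])
       (auto simp: finite_abs_int_segment inj_def vec_eq_iff)
  moreover have "{v :: real^'k. v \<in> int_vecs \<and> norm v \<le> R} \<subseteq> vec_nth -` (UNIV \<rightarrow>\<^sub>E ?I)"
    by (auto simp: int_vecs_def) (metis component_le_norm_cart order_trans)
  ultimately show ?thesis by (rule finite_subset[rotated])
qed

lemma prim_vecs_imp_int_vecs: "v \<in> prim_vecs \<Longrightarrow> v \<in> int_vecs"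
  and prim_vecs_nonzero: "v \<in> prim_vecs \<Longrightarrow> v \<noteq> 0"
  by (auto simp: prim_vecs_def int_vecs_def vec_eq_iff)

lemma int_vecs_multiple_of_prim:
  fixes v :: "real^'k::finite"
  assumes "v \<in> int_vecs" "v \<noteq> 0"
  obtains w c where "w \<in> prim_vecs" "c \<ge> 1" "v = c *\<^sub>R w"
proof -
  have "\<forall>i. \<exists>z. v $ i = of_int z" using assms(1) by (auto simp: int_vecs_def Ints_def)
  then obtain z where z: "\<And>i. v $ i = of_int (z i)" by metis
  define g where "g = Gcd (range z)"
  have g0: "g \<noteq> 0" using assms(2) by (auto simp: g_def z vec_eq_iff)
  then have g1: "g \<ge> 1"
    unfolding g_def by (metis Gcd_int_greater_eq_0 int_one_le_iff_zero_less order_less_le)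
  have "g dvd z i" for i by (simp add: g_def)
  then obtain y where y: "\<And>i. z i = g * y i" unfolding dvd_def by metis
  have "range z = (*) g ` range y" by (auto simp: y)
  then have "g = Gcd ((*) g ` range y)" by (simp only: g_def)
  also have "\<dots> = g * Gcd (range y)" using g1 by (simp add: Gcd_mult)
  finally have "Gcd (range y) = 1" using g0 by simp
  moreover have "(\<chi> i. y i) \<noteq> 0" using assms(2) by (auto simp: vec_eq_iff z y)
  ultimately have "(\<chi> i. of_int (y i)) \<in> (prim_vecs :: (real^'k) set)"
    unfolding prim_vecs_def by (intro CollectI exI[of _ "\<chi> i. y i"]) auto
  then show ?thesis
    by (rule that[of _ "of_int g"]) (use g1 in \<open>auto simp: vec_eq_iff z y\<close>)
qed

lemma norm_matrix_vector_mult_le: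
  fixes B :: "real^'n::finite^'m::finite"
  shows "norm (B *v x) \<le> norm B * norm x"
proof -
  have "norm (B *v x) = L2_set (\<lambda>i. norm (B $ i \<bullet> x)) UNIV"
    by (simp add: norm_vec_def matrix_vector_mul_component)
  also have "\<dots> \<le> L2_set (\<lambda>i. norm (B $ i) * norm x) UNIV"
    by (intro L2_set_mono) (auto simp: Cauchy_Schwarz_ineq2)
  also have "\<dots> = norm B * norm x"
    by (simp add: norm_vec_def[of B] L2_set_left_distrib)
  finally show ?thesis .
qed

section \<open>The Diophantine exponent\<close>

text \<open>The error of \<open>v\<close> as an approximation to \<open>A\<close>, denoted \<open>a\<close> above.\<close>

definition err :: "real^'n::finite^'m::finite \<Rightarrow> real^('m + 'n) \<Rightarrow> real" where
  "err A v = norm (A *v p2 v - p1 v)"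

text \<open>
  The integer solutions of the inequality with exponent \<open>\<nu>\<close>. The sets decrease as \<open>\<nu>\<close> grows
  because \<open>\<parallel>p\<^sub>2 v\<parallel> \<ge> 1\<close>, so \<open>\<mu>\<close> separates the positive
  exponents with an infinite set from those with a finite one.
\<close>

definition approx_set :: "real^'n::finite^'m::finite \<Rightarrow> real \<Rightarrow> (real^('m + 'n)) set" where
  "approx_set A \<nu> = {v. v \<in> int_vecs \<and> p2 v \<noteq> 0 \<and> err A v \<le> norm (p2 v) powr (1 - \<nu>)}"

lemma mu_altdef: "mu A = Sup (ereal ` {\<nu>. \<nu> > 0 \<and> infinite (approx_set A \<nu>)})"
  by (simp add: mu_def approx_set_def err_def)

lemma err_scaleR: "err A (c *\<^sub>R v) = \<bar>c\<bar> * err A v"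
  by (simp add: err_def p1_scaleR p2_scaleR matrix_vector_mult_scaleR
      scaleR_diff_right[symmetric])

lemma approx_set_antimono:
  assumes "\<nu> \<le> \<nu>'"
  shows "approx_set A \<nu>' \<subseteq> approx_set A \<nu>"
proof
  fix v assume v: "v \<in> approx_set A \<nu>'"
  then have "norm (p2 v) \<ge> 1" by (auto simp: approx_set_def intro: int_vecs_norm_ge_1 int_vecs_p2)
  then have "norm (p2 v) powr (1 - \<nu>') \<le> norm (p2 v) powr (1 - \<nu>)"
    using assms by (intro powr_mono) auto
  with v show "v \<in> approx_set A \<nu>" by (auto simp: approx_set_def)
qed

lemma infinite_approx_set:
  assumes "0 < \<nu>" "ereal \<nu> < mu A"
  shows "infinite (approx_set A \<nu>)"
proof -
  obtain \<nu>' where "infinite (approx_set A \<nu>')" "\<nu> < \<nu>'"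
    using assms(2) by (auto simp: mu_altdef less_Sup_iff)
  then show ?thesis using approx_set_antimono[of \<nu> \<nu>' A] by (meson finite_subset less_imp_le)
qed

lemma finite_approx_set:
  assumes "0 < \<nu>" "mu A < ereal \<nu>"
  shows "finite (approx_set A \<nu>)"
proof (rule ccontr)
  assume "infinite (approx_set A \<nu>)"
  then have "ereal \<nu> \<le> mu A" unfolding mu_altdef using assms(1) by (intro Sup_upper) auto
  with assms(2) show False by simp
qed

text \<open>
  Rounding \<open>A q\<close> to the nearest integer vector gives a bounded error, which is enough for every
  exponent below \<open>1\<close>.
\<close>

lemma mu_ge_1: "1 \<le> mu (A :: real^'n::finite^'m::finite)"
proof (rule dense_le)
  have inf: "infinite (approx_set A \<nu>)" if "0 < \<nu>" "\<nu> < 1" for \<nu>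
  proof -
    define M where "M = real CARD('m) + 1"
    define q :: "nat \<Rightarrow> real^'n" where "q k = (\<chi> j. real k)" for k
    define V :: "nat \<Rightarrow> real^('m + 'n)" where
      "V k = (\<chi> i. case i of Inl a \<Rightarrow> of_int (round ((A *v q k) $ a)) | Inr b \<Rightarrow> real k)" for k
    have p2V: "p2 (V k) = q k" for k by (simp add: vec_eq_iff p2_def V_def q_def)
    have err: "err A (V k) \<le> M" for k
    proof -
      have "err A (V k) \<le> (\<Sum>i\<in>UNIV. \<bar>(A *v q k - p1 (V k)) $ i\<bar>)"
        unfolding err_def p2V by (rule norm_le_l1_cart)
      also have "\<dots> \<le> (\<Sum>i\<in>(UNIV :: 'm set). 1)"
      proof (rule sum_mono)
        fix i
        have "\<bar>of_int (round ((A *v q k) $ i)) - (A *v q k) $ i\<bar> \<le> 1 / 2"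
          by (rule of_int_round_abs_le)
        then show "\<bar>(A *v q k - p1 (V k)) $ i\<bar> \<le> 1" by (simp add: p1_def V_def abs_minus_commute)
      qed
      finally show ?thesis by (simp add: M_def)
    qed
    have norm_q: "real k \<le> norm (q k)" for k
      using component_le_norm_cart[of "q k" undefined] by (simp add: q_def)
    have "\<forall>\<^sub>F k in sequentially. M \<le> real k powr (1 - \<nu>)"
      using that by real_asymp
    then obtain N where N: "\<And>k. k \<ge> N \<Longrightarrow> M \<le> real k powr (1 - \<nu>)"
      by (auto simp: eventually_sequentially)
    have "V k \<in> approx_set A \<nu>" if "k \<ge> Suc N" for k
    proof -
      have "err A (V k) \<le> real k powr (1 - \<nu>)" using err[of k] N[of k] that by simp
      also have "\<dots> \<le> norm (q k) powr (1 - \<nu>)"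
        using norm_q[of k] \<open>\<nu> < 1\<close> by (intro powr_mono2) auto
      finally have "err A (V k) \<le> norm (p2 (V k)) powr (1 - \<nu>)" by (simp add: p2V)
      moreover have "p2 (V k) \<noteq> 0" using that by (simp add: p2V q_def vec_eq_iff)
      moreover have "V k \<in> int_vecs" by (auto simp: int_vecs_def V_def split: sum.split)
      ultimately show ?thesis by (simp add: approx_set_def)
    qed
    then have "V ` {Suc N..} \<subseteq> approx_set A \<nu>" by auto
    moreover have "inj V" by (rule injI) (metis p2V q_def of_nat_eq_iff vec_lambda_beta)
    then have "infinite (V ` {Suc N..})"
      by (meson finite_imageD infinite_Ici inj_on_subset subset_UNIV)
    ultimately show ?thesis by (rule infinite_super)
  qed
  fix y :: ereal assume "y < 1"
  then have "max y 0 < 1" by simp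
  then obtain \<nu> where \<nu>: "max y 0 < ereal \<nu>" "ereal \<nu> < 1"
    using ereal_dense2 by blast
  then have "0 < \<nu>" "\<nu> < 1" by (auto simp: zero_ereal_def one_ereal_def simp del: ereal_less_eq)
  then have "ereal \<nu> \<le> mu A" unfolding mu_altdef using inf by (intro Sup_upper) auto
  with \<nu>(1) show "y \<le> mu A" by auto
qed

text \<open>
  A real number \<open>\<kappa> < 1\<close> corresponds to the exponent \<open>\<nu> = 1 / (1 - \<kappa>)\<close>. If \<open>\<mu> = \<infinity>\<close>, only numbers
  \<open>\<kappa> > 1\<close> lie above \<open>1 - 1 / \<mu>\<close>; therefore the upper estimate below includes \<open>\<kappa> \<ge> 1\<close>.
\<close>

lemma mu_less_iff:
  assumes "\<kappa> < 1"
  shows "1 - 1 / mu A < ereal \<kappa> \<longleftrightarrow> mu A < ereal (1 / (1 - \<kappa>))"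
    and "ereal \<kappa> < 1 - 1 / mu A \<longleftrightarrow> ereal (1 / (1 - \<kappa>)) < mu A"
proof -
  show "1 - 1 / mu A < ereal \<kappa> \<longleftrightarrow> mu A < ereal (1 / (1 - \<kappa>))"
    using mu_ge_1[of A] assms by (cases "mu A") (auto simp: one_ereal_def field_simps)
  show "ereal \<kappa> < 1 - 1 / mu A \<longleftrightarrow> ereal (1 / (1 - \<kappa>)) < mu A"
    using mu_ge_1[of A] assms by (cases "mu A") (auto simp: one_ereal_def field_simps)
qed

lemma one_minus_inverse_mu_bounds: "0 \<le> 1 - 1 / mu A" "1 - 1 / mu A \<le> 1"
  using mu_ge_1[of A] by (cases "mu A"; auto simp: one_ereal_def zero_ereal_def)+

text \<open>
  The constant \<open>C\<close> absorbs the vectors with \<open>p\<^sub>2 v = 0\<close>, for which \<open>a \<ge> 1\<close>, and the finitely many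
  solutions with exponent \<open>1 / (1 - \<kappa>)\<close>. For \<open>\<kappa> \<ge> 1\<close> no solutions have to be excluded, since
  then \<open>T / b \<le> T powr \<kappa>\<close> whenever \<open>b \<ge> 1\<close> and \<open>T \<ge> 1\<close>.
\<close>

lemma mu_upper:
  fixes A :: "real^'n::finite^'m::finite"
  assumes irr: "\<And>v. v \<in> int_vecs \<Longrightarrow> v \<noteq> 0 \<Longrightarrow> 0 < err A v"
    and \<kappa>: "1 - 1 / mu A < ereal \<kappa>"
  obtains C where "0 < C"
    "\<And>v T. v \<in> int_vecs \<Longrightarrow> v \<noteq> 0 \<Longrightarrow> 1 \<le> T \<Longrightarrow>
       1 / max (err A v) (norm (p2 v) / T) \<le> max C (T powr \<kappa>)"
proof -
  define S where "S = (if \<kappa> < 1 then approx_set A (1 / (1 - \<kappa>)) else {})"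
  define C where "C = 1 + (\<Sum>v\<in>S. 1 / err A v)"
  have finS: "finite S"
    using \<kappa> mu_less_iff(1)[of \<kappa> A] by (auto simp: S_def intro!: finite_approx_set)
  have S0: "0 < err A v" if "v \<in> S" for v
    using that by (auto simp: S_def approx_set_def split: if_splits intro!: irr)
  have "0 \<le> (\<Sum>v\<in>S. 1 / err A v)" using S0 by (intro sum_nonneg) (simp add: less_imp_le)
  then have C1: "1 \<le> C" by (simp add: C_def)
  have "1 / max (err A v) (norm (p2 v) / T) \<le> max C (T powr \<kappa>)"
    if v: "v \<in> int_vecs" "v \<noteq> 0" and T: "1 \<le> T" for v T
  proof -
    define a where "a = err A v"
    define b where "b = norm (p2 v)"
    have a0: "a > 0" using irr v by (simp add: a_def)
    have le_a: "1 / max a (b / T) \<le> 1 / a" using a0 by (intro divide_left_mono) auto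
    consider "p2 v = 0" | "p2 v \<noteq> 0" "v \<in> S" | "p2 v \<noteq> 0" "v \<notin> S" by blast
    then have "1 / max a (b / T) \<le> max C (T powr \<kappa>)"
    proof cases
      case 1
      then have "a = norm (p1 v)" by (simp add: a_def err_def)
      also have "\<dots> \<ge> 1" using 1 v p1_eq_0_p2_eq_0 by (intro int_vecs_norm_ge_1 int_vecs_p1) auto
      finally have "1 / a \<le> 1" by simp
      then show ?thesis using le_a C1 by linarith
    next
      case 2
      have "1 / err A v \<le> (\<Sum>v\<in>S. 1 / err A v)"
        using finS 2 S0 by (intro member_le_sum) (auto intro: less_imp_le)
      then show ?thesis using le_a by (simp add: C_def a_def)
    next
      case 3
      then have b1: "b \<ge> 1" unfolding b_def by (intro int_vecs_norm_ge_1 int_vecs_p2 v)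
      have "1 / max a (b / T) \<le> 1 / (b / T)"
        using a0 b1 T by (intro divide_left_mono mult_pos_pos) auto
      then have le_b: "1 / max a (b / T) \<le> T / b" by simp
      show ?thesis
      proof (cases "b \<le> T powr (1 - \<kappa>)")
        case False
        then have "T / b \<le> T / T powr (1 - \<kappa>)" using T b1 by (intro divide_left_mono) auto
        also have "\<dots> = T powr \<kappa>" using T by (simp add: powr_diff)
        finally show ?thesis using le_b by linarith
      next
        case True
        show ?thesis
        proof (cases "\<kappa> < 1")
          case False
          have "T / b \<le> T" using b1 T by (simp add: field_simps)
          also have "T = T powr 1" using T by simp
          also have "\<dots> \<le> T powr \<kappa>" using False T by (intro powr_mono) auto
          finally show ?thesis using le_b by linarith
        next
          case k1: True
          define \<nu> where "\<nu> = 1 / (1 - \<kappa>)"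
          have \<nu>: "(1 - \<kappa>) * (\<nu> - 1) = \<kappa>" using k1 by (simp add: \<nu>_def field_simps)
          have "0 \<le> 1 - 1 / mu A" by (rule one_minus_inverse_mu_bounds)
          also note \<kappa>
          finally have "0 < \<kappa>" by (simp add: zero_ereal_def)
          then have "\<nu> > 1" using k1 by (simp add: \<nu>_def field_simps)
          have "b powr (1 - \<nu>) < a"
            using 3 v k1 by (auto simp: S_def approx_set_def a_def b_def \<nu>_def)
          then have "1 / a \<le> 1 / b powr (1 - \<nu>)" using b1 a0 by (intro divide_left_mono) auto
          also have "\<dots> = b powr (\<nu> - 1)" by (simp add: powr_minus_divide[symmetric])
          also have "\<dots> \<le> (T powr (1 - \<kappa>)) powr (\<nu> - 1)"
            using True b1 \<open>\<nu> > 1\<close> by (intro powr_mono2) auto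
          also have "\<dots> = T powr \<kappa>" by (simp add: powr_powr \<nu>)
          finally show ?thesis using le_a by linarith
        qed
      qed
    qed
    then show ?thesis by (simp add: a_def b_def)
  qed
  with that[of C] C1 show ?thesis by simp
qed

text \<open>
  The last conclusion is \<open>(b / a) powr \<kappa> \<le> 1 / a\<close> in logarithmic form; \<open>\<kappa>\<close> may be negative.
\<close>

lemma mu_lower:
  fixes A :: "real^'n::finite^'m::finite"
  assumes irr: "\<And>v. v \<in> int_vecs \<Longrightarrow> v \<noteq> 0 \<Longrightarrow> 0 < err A v"
    and \<kappa>: "ereal \<kappa> < 1 - 1 / mu A"
  obtains v where "v \<in> prim_vecs" "N \<le> norm (p2 v) / err A v"
    "\<kappa> * ln (norm (p2 v) / err A v) \<le> ln (1 / err A v)"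
proof -
  define \<nu> where "\<nu> = 1 / (1 - \<kappa>)"
  have "ereal \<kappa> < 1" using \<kappa> one_minus_inverse_mu_bounds(2)[of A] by (rule less_le_trans)
  then have k1: "\<kappa> < 1" by (simp add: one_ereal_def)
  then have \<nu>0: "0 < \<nu>" and \<nu>: "(1 - \<kappa>) * (1 - \<nu>) = - \<kappa>" by (simp_all add: \<nu>_def field_simps)
  have inf: "infinite (approx_set A \<nu>)"
    using \<nu>0 \<kappa> mu_less_iff(2)[OF k1] by (intro infinite_approx_set) (auto simp: \<nu>_def)
  have S: "v \<in> int_vecs" "v \<noteq> 0" "0 < err A v" "1 \<le> norm (p2 v)"
    "err A v \<le> norm (p2 v) powr (1 - \<nu>)" if "v \<in> approx_set A \<nu>" for v
  proof -
    show *: "v \<in> int_vecs" "v \<noteq> 0" "err A v \<le> norm (p2 v) powr (1 - \<nu>)"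
      using that by (auto simp: approx_set_def)
    show "0 < err A v" using irr * by blast
    show "1 \<le> norm (p2 v)"
      using that by (intro int_vecs_norm_ge_1 int_vecs_p2) (auto simp: approx_set_def)
  qed
  \<comment> \<open>An upper bound on \<open>b / a\<close> would bound \<open>b\<close>, then \<open>a\<close>, and finally \<open>v\<close>.\<close>
  have "\<exists>v\<in>approx_set A \<nu>. N \<le> norm (p2 v) / err A v"
  proof (rule ccontr)
    assume *: "\<not> ?thesis"
    define M where "M = \<bar>N\<bar> powr (1 / \<nu>)"
    have "norm v \<le> 2 * (M + norm A * M)" if v: "v \<in> approx_set A \<nu>" for v
    proof -
      let ?a = "err A v" and ?b = "norm (p2 v)"
      note S = S[OF v]
      have "?b powr \<nu> = ?b / ?b powr (1 - \<nu>)" using S by (simp add: powr_diff)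
      also have "\<dots> \<le> ?b / ?a" using S by (intro divide_left_mono mult_pos_pos) auto
      also have "\<dots> \<le> \<bar>N\<bar>" using * v by force
      finally have "(?b powr \<nu>) powr (1 / \<nu>) \<le> M"
        unfolding M_def using \<nu>0 by (intro powr_mono2) auto
      then have b: "?b \<le> M" using \<nu>0 S by (simp add: powr_powr)
      have "?b powr (1 - \<nu>) \<le> ?b powr 1" using S \<nu>0 by (intro powr_mono) auto
      then have a: "?a \<le> M" using S b by simp
      have "norm (p1 v) \<le> norm (A *v p2 v) + norm (A *v p2 v - p1 v)"
        by (metis norm_triangle_sub norm_minus_commute)
      also have "\<dots> \<le> norm A * ?b + ?a"
        using norm_matrix_vector_mult_le[of A "p2 v"] by (simp add: err_def)
      also have "\<dots> \<le> norm A * M + M" using a b by (intro add_mono mult_left_mono) auto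
      finally have "norm (p1 v) \<le> M + norm A * M" by simp
      moreover have "?b \<le> M + norm A * M" using b by (simp add: M_def add_increasing2)
      ultimately show ?thesis using norm_le_mnorm[of v] by (simp add: mnorm_def)
    qed
    then have "approx_set A \<nu> \<subseteq> {v. v \<in> int_vecs \<and> norm v \<le> 2 * (M + norm A * M)}"
      using S(1) by auto
    with inf show False using finite_int_vecs_norm_le finite_subset by blast
  qed
  then obtain v where v: "v \<in> approx_set A \<nu>" and N: "N \<le> norm (p2 v) / err A v" by blast
  note S = S[OF v]
  obtain w c where w: "w \<in> prim_vecs" "c \<ge> 1" "v = c *\<^sub>R w"
    using S int_vecs_multiple_of_prim by blast
  have quot: "norm (p2 w) / err A w = norm (p2 v) / err A v"
    using w by (simp add: err_scaleR p2_scaleR)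
  have a: "0 < err A w" using irr w prim_vecs_imp_int_vecs prim_vecs_nonzero by blast
  have b: "p2 v \<noteq> 0" using v by (simp add: approx_set_def)
  then have ln_err: "ln (err A v) \<le> (1 - \<nu>) * ln (norm (p2 v))"
    using S ln_le_cancel_iff[of "err A v" "norm (p2 v) powr (1 - \<nu>)"] by (simp add: ln_powr)
  have "(1 - \<kappa>) * ln (err A v) \<le> (1 - \<kappa>) * ((1 - \<nu>) * ln (norm (p2 v)))"
    using ln_err k1 by (intro mult_left_mono) auto
  also have "\<dots> = - \<kappa> * ln (norm (p2 v))" by (simp add: \<nu> mult.assoc[symmetric])
  finally have "\<kappa> * ln (norm (p2 v) / err A v) \<le> - ln (err A v)"
    using S b by (simp add: ln_div algebra_simps)
  also have "\<dots> \<le> - ln (err A w)"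
    using w a by (simp add: err_scaleR mult_le_cancel_right1)
  also have "\<dots> = ln (1 / err A w)" using a by (simp add: ln_div)
  finally show ?thesis using that[of w] w N quot by simp
qed

section \<open>Lattice vectors under the two actions\<close>

lemma p1_block: "p1 (block P Q R S *v v) = P *v p1 v + Q *v p2 v"
  and p2_block: "p2 (block P Q R S *v v) = R *v p1 v + S *v p2 v"
  by (simp_all add: vec_eq_iff matrix_vector_mult_def block_def p1_def p2_def
      UNIV_Plus_UNIV[symmetric] sum.Plus del: UNIV_Plus_UNIV)

text \<open>The matrix representing \<open>x_pt A\<close>; it sends \<open>v\<close> to \<open>(p\<^sub>1 v - A (p\<^sub>2 v), p\<^sub>2 v)\<close>.\<close>

definition lat :: "real^'n::finite^'m::finite \<Rightarrow> real^('m + 'n)^('m + 'n)" where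
  "lat A = block (mat 1) (- A) 0 (mat 1)"

lemma uminus_matrix_vector_mult:
  "(- A) *v x = - (A *v x)" for A :: "real^'n::finite^'m::finite"
  by (simp add: vec_eq_iff matrix_vector_mult_def sum_negf)

lemma p1_lat: "p1 (lat A *v v) = p1 v - A *v p2 v"
  and p2_lat: "p2 (lat A *v v) = p2 v"
  by (simp_all add: lat_def p1_block p2_block uminus_matrix_vector_mult)

lemma norm_p1_lat: "norm (p1 (lat A *v v)) = err A v"
  by (simp add: p1_lat err_def norm_minus_commute)

lemma Lam_act_x_pt: "Lam (act h (x_pt A)) = (\<lambda>v. h *v (lat A *v v)) ` prim_vecs"
  by (simp add: x_pt_def lat_def act_SL_coset Lam_SL_coset matrix_vector_mul_assoc)

lemma alpha1_upper:
  assumes "h \<in> SL_R" "\<And>v. v \<in> prim_vecs \<Longrightarrow> 1 / mnorm (h *v (lat A *v v)) \<le> K"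
  shows "alpha1 (act h (x_pt A)) \<le> K"
  unfolding alpha1_def
  using alpha1_wf(1)[OF act_X_space[OF assms(1) x_pt_in_X_space]] assms(2)
  by (intro cSUP_least) (auto simp: Lam_act_x_pt)

lemma alpha1_lower:
  assumes "h \<in> SL_R" "v \<in> prim_vecs"
  shows "1 / mnorm (h *v (lat A *v v)) \<le> alpha1 (act h (x_pt A))"
  unfolding alpha1_def
  by (rule cSUP_upper[OF _ alpha1_wf(2)[OF act_X_space[OF assms(1) x_pt_in_X_space]]])
     (use assms(2) in \<open>auto simp: Lam_act_x_pt\<close>)

lemma alpha1_pos:
  assumes "x \<in> X_space"
  shows "0 < alpha1 x"
proof -
  obtain g where x: "x = SL_coset g" and g: "det g = 1"
    using assms by (auto simp: X_space_def SL_R_def)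
  obtain v where v: "v \<in> Lam x" using alpha1_wf(1)[OF assms] by blast
  then obtain z where z: "z \<in> prim_vecs" "v = g *v z" by (auto simp: x Lam_SL_coset)
  have "inj ((*v) g)" using g by (simp add: inj_matrix_vector_mult invertible_det_nz)
  then have "v \<noteq> 0" using z prim_vecs_nonzero by (metis injD matrix_vector_mult_0_right)
  then have "0 < 1 / mnorm v"
    using norm_le_mnorm[of v] by (smt (verit) divide_pos_pos zero_less_norm_iff)
  also have "\<dots> \<le> alpha1 x"
    unfolding alpha1_def by (rule cSUP_upper[OF v alpha1_wf(2)[OF assms]])
  finally show ?thesis .
qed

lemma mnorm_g_flow_lat:
  fixes A :: "real^'n::finite^'m::finite"
  shows "mnorm (g_flow t *v (lat A *v v)) =
    exp (real CARD('n) / real (CARD('m) + CARD('n)) * t) * max (err A v) (norm (p2 v) / exp t)"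
proof -
  let ?e = "real CARD('n) / real (CARD('m) + CARD('n)) * t"
  have mv: "mat c *v x = c *\<^sub>R x" for c and x :: "real^'k::finite"
    by (simp add: vec_eq_iff matrix_vector_mult_def mat_def if_distrib[of "\<lambda>x. x * _"] cong: if_cong)
  have "0 < real CARD('m) + real CARD('n)" by (simp add: add_pos_pos)
  then have "- (real CARD('m) * t / real (CARD('m) + CARD('n))) = ?e - t"
    by (simp add: field_simps)
  then have g: "(g_flow t :: real^('m + 'n)^('m + 'n)) = block (mat (exp ?e)) 0 0 (mat (exp (?e - t)))"
    by (simp add: g_flow_def)
  have "mnorm (g_flow t *v (lat A *v v)) = max (exp ?e * err A v) (exp ?e * (norm (p2 v) / exp t))"
    unfolding g mnorm_def p1_block p2_block mv
    by (simp add: norm_p1_lat p2_lat exp_diff)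
  then show ?thesis by (simp add: max_mult_distrib_left)
qed

lemma mnorm_h_mat_lat: "mnorm (h_mat B *v (lat A *v v)) =
    max (err A v) (norm (B *v p1 (lat A *v v) + p2 v))"
  unfolding mnorm_def h_mat_def p1_block p2_block by (simp add: norm_p1_lat p2_lat)

text \<open>
  If \<open>r\<close> is the norm of the lattice vector after applying \<open>h_mat B\<close>, then \<open>a \<le> r\<close> and \<open>b \<le> s a + r \<le> (s + 1) r\<close>.
\<close>

lemma mnorm_h_mat_lat_ge:
  assumes "norm B \<le> s" "0 \<le> s"
  shows "max (err A v) (norm (p2 v) / (s + 1)) \<le> mnorm (h_mat B *v (lat A *v v))"
proof -
  let ?m = "mnorm (h_mat B *v (lat A *v v))" and ?u = "B *v p1 (lat A *v v)"
  have a: "err A v \<le> ?m" by (simp add: mnorm_h_mat_lat)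
  have "norm ?u \<le> s * err A v"
    using norm_matrix_vector_mult_le[of B "p1 (lat A *v v)"] assms
      mult_right_mono[OF assms(1), of "err A v"]
    by (simp add: norm_p1_lat err_def)
  also have "\<dots> \<le> s * ?m" using a assms by (intro mult_left_mono)
  finally have "norm (p2 v) \<le> s * ?m + norm (?u + p2 v)"
    using norm_triangle_ineq4[of "?u + p2 v" ?u] by simp
  also have "norm (?u + p2 v) \<le> ?m" by (simp add: mnorm_h_mat_lat)
  finally have "norm (p2 v) / (s + 1) \<le> ?m" using assms by (simp add: field_simps)
  with a show ?thesis by simp
qed

text \<open>The rank-one matrix sending \<open>p\<^sub>1\<close> of a lattice vector to minus its \<open>p\<^sub>2\<close>.\<close>

lemma h_mat_cancelling_p2:
  fixes A :: "real^'n::finite^'m::finite"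
  assumes "0 < err A v"
  obtains B where "norm B = norm (p2 v) / err A v" "mnorm (h_mat B *v (lat A *v v)) = err A v"
proof -
  define u where "u = p1 (lat A *v v)"
  define B :: "real^'m^'n" where "B = (\<chi> j. (- (p2 v $ j) / (err A v)\<^sup>2) *\<^sub>R u)"
  have u: "norm u = err A v" by (simp add: u_def norm_p1_lat)
  have "norm B = L2_set (\<lambda>j. norm (p2 v $ j) * (1 / err A v)) UNIV"
    unfolding norm_vec_def[of B] by (rule L2_set_cong) (use assms in \<open>auto simp: B_def u power2_eq_square\<close>)
  also have "\<dots> = norm (p2 v) / err A v"
    using assms by (subst L2_set_left_distrib[symmetric]) (auto simp: norm_vec_def[of "p2 v"])
  finally have 1: "norm B = norm (p2 v) / err A v" .
  have "B *v u = - p2 v"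
    using assms by (simp add: vec_eq_iff matrix_vector_mul_component B_def dot_square_norm u)
  then have 2: "mnorm (h_mat B *v (lat A *v v)) = err A v"
    using assms by (simp add: mnorm_h_mat_lat u_def[symmetric])
  from 1 2 show ?thesis by (rule that)
qed

section \<open>The two growth exponents\<close>

text \<open>
  The form in which the estimates in terms of \<open>\<mu>\<close> are used. The shift \<open>c\<close> and the constant \<open>C\<close> have
  no effect on the limit, because \<open>\<kappa> > L \<ge> 0\<close> makes the power tend to infinity.
\<close>

lemma Limsup_log_quotient_eqI:
  fixes f :: "real \<Rightarrow> ereal"
  assumes "0 \<le> L"
    and upper: "\<And>\<kappa>. L < ereal \<kappa> \<Longrightarrow>
      \<exists>C. \<forall>\<^sub>F s in at_top. f s \<le> ereal (ln (max C ((s + c) powr \<kappa>)) / ln s)"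
    and lower: "\<And>\<kappa> N. ereal \<kappa> < L \<Longrightarrow> \<exists>s\<ge>N. ereal \<kappa> \<le> f s"
  shows "Limsup at_top f = L"
proof (rule antisym)
  show "Limsup at_top f \<le> L"
  proof (rule dense_ge)
    fix y assume y: "L < y"
    show "Limsup at_top f \<le> y"
    proof (cases y)
      case (real \<kappa>)
      then have "0 < \<kappa>" using y assms(1) by (metis ereal_less(2) le_less_trans)
      obtain C where C: "\<forall>\<^sub>F s in at_top. f s \<le> ereal (ln (max C ((s + c) powr \<kappa>)) / ln s)"
        using upper[of \<kappa>] y real by auto
      have "\<forall>\<^sub>F s in at_top. C \<le> (s + c) powr \<kappa>" using \<open>0 < \<kappa>\<close> by real_asymp
      then have "\<forall>\<^sub>F s in at_top. ln ((s + c) powr \<kappa>) / ln s = ln (max C ((s + c) powr \<kappa>)) / ln s"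
        by eventually_elim (simp add: max_absorb2)
      moreover have "((\<lambda>s. ln ((s + c) powr \<kappa>) / ln s) \<longlongrightarrow> \<kappa>) at_top"
        using \<open>0 < \<kappa>\<close> by real_asymp
      ultimately have "((\<lambda>s. ln (max C ((s + c) powr \<kappa>)) / ln s) \<longlongrightarrow> \<kappa>) at_top"
        by (rule Lim_transform_eventually[rotated])
      then have "Limsup at_top (\<lambda>s. ereal (ln (max C ((s + c) powr \<kappa>)) / ln s)) = ereal \<kappa>"
        by (intro lim_imp_Limsup) auto
      with Limsup_mono[OF C] real show ?thesis by simp
    qed (use y in auto)
  qed
next
  show "L \<le> Limsup at_top f"
  proof (rule ccontr)
    assume "\<not> ?thesis"
    then obtain \<kappa> where \<kappa>: "Limsup at_top f < ereal \<kappa>" "ereal \<kappa> < L"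
      using ereal_dense2 by (metis not_le)
    from Limsup_lessD[OF \<kappa>(1)] obtain N where "\<And>s. s \<ge> N \<Longrightarrow> f s < ereal \<kappa>"
      by (auto simp: eventually_at_top_linorder)
    with lower[OF \<kappa>(2), of N] show False by (meson not_le)
  qed
qed

lemma beta_x_pt:
  fixes A :: "real^'n::finite^'m::finite"
  assumes irr: "\<And>v. v \<in> int_vecs \<Longrightarrow> v \<noteq> 0 \<Longrightarrow> 0 < err A v"
  shows "beta (x_pt A) = 1 - 1 / mu A"
  unfolding beta_def
proof (rule Limsup_log_quotient_eqI[where c = 1])
  show "0 \<le> 1 - 1 / mu A" by (rule one_minus_inverse_mu_bounds)
next
  fix \<kappa> assume "1 - 1 / mu A < ereal \<kappa>"
  then obtain C where C: "0 < C" "\<And>v T. v \<in> int_vecs \<Longrightarrow> v \<noteq> 0 \<Longrightarrow> 1 \<le> T \<Longrightarrow>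
       1 / max (err A v) (norm (p2 v) / T) \<le> max C (T powr \<kappa>)"
    using mu_upper[OF irr] by blast
  have bound: "(SUP h\<in>h_ball s. ereal (ln (alpha1 (act h (x_pt A))))) / ereal (ln s)
      \<le> ereal (ln (max C ((s + 1) powr \<kappa>)) / ln s)" if s: "2 \<le> s" for s
  proof -
    have "ln (alpha1 (act h (x_pt A))) \<le> ln (max C ((s + 1) powr \<kappa>))" if h: "h \<in> h_ball s" for h
    proof -
      from h obtain B where B: "h = h_mat B" "norm B \<le> s" by (auto simp: h_ball_def)
      have hS: "h \<in> SL_R" using h h_ball_SL_R by blast
      have "alpha1 (act h (x_pt A)) \<le> max C ((s + 1) powr \<kappa>)"
      proof (rule alpha1_upper[OF hS])
        fix v :: "real^('m + 'n)" assume v: "v \<in> prim_vecs"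
        note v = prim_vecs_imp_int_vecs[OF v] prim_vecs_nonzero[OF v]
        have "0 < max (err A v) (norm (p2 v) / (s + 1))" using irr[OF v] by simp
        with mnorm_h_mat_lat_ge[OF B(2), of A v] s
        have "1 / mnorm (h *v (lat A *v v)) \<le> 1 / max (err A v) (norm (p2 v) / (s + 1))"
          unfolding B by (intro divide_left_mono) auto
        also have "\<dots> \<le> max C ((s + 1) powr \<kappa>)" using C(2)[OF v, of "s + 1"] s by simp
        finally show "1 / mnorm (h *v (lat A *v v)) \<le> max C ((s + 1) powr \<kappa>)" .
      qed
      then show ?thesis
        using alpha1_pos[OF act_X_space[OF hS x_pt_in_X_space[of A]]] by (intro ln_mono) auto
    qed
    then have "(SUP h\<in>h_ball s. ereal (ln (alpha1 (act h (x_pt A)))))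
        \<le> ereal (ln (max C ((s + 1) powr \<kappa>)))"
      by (intro SUP_least) auto
    then have "(SUP h\<in>h_ball s. ereal (ln (alpha1 (act h (x_pt A))))) / ereal (ln s)
        \<le> ereal (ln (max C ((s + 1) powr \<kappa>))) / ereal (ln s)"
      using s by (intro ereal_divide_right_mono) auto
    then show ?thesis using s by simp
  qed
  show "\<exists>C. \<forall>\<^sub>F s in at_top. (SUP h\<in>h_ball s. ereal (ln (alpha1 (act h (x_pt A))))) / ereal (ln s)
      \<le> ereal (ln (max C ((s + 1) powr \<kappa>)) / ln s)"
    using bound by (auto intro!: exI[of _ C] eventually_at_top_linorderI[of 2])
next
  fix \<kappa> N assume "ereal \<kappa> < 1 - 1 / mu A"
  then obtain v where v: "v \<in> prim_vecs" "max 2 N \<le> norm (p2 v) / err A v"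
    "\<kappa> * ln (norm (p2 v) / err A v) \<le> ln (1 / err A v)"
    using mu_lower[OF irr, where N = "max 2 N"] by metis
  define s where "s = norm (p2 v) / err A v"
  have a: "0 < err A v" using irr v prim_vecs_imp_int_vecs prim_vecs_nonzero by blast
  then obtain B where B: "norm B = s" "mnorm (h_mat B *v (lat A *v v)) = err A v"
    using h_mat_cancelling_p2 unfolding s_def by blast
  have s: "2 \<le> s" "N \<le> s" using v(2) by (auto simp: s_def)
  have h: "h_mat B \<in> h_ball s" using B by (auto simp: h_ball_def)
  have "1 / err A v \<le> alpha1 (act (h_mat B) (x_pt A))"
    using alpha1_lower[of "h_mat B" v A] h h_ball_SL_R v(1) unfolding B(2) by blast
  then have "ln (1 / err A v) \<le> ln (alpha1 (act (h_mat B) (x_pt A)))"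
    using a by (intro ln_mono) auto
  with v(3) have "ereal (\<kappa> * ln s) \<le> ereal (ln (alpha1 (act (h_mat B) (x_pt A))))"
    by (simp add: s_def)
  also have "\<dots> \<le> (SUP h\<in>h_ball s. ereal (ln (alpha1 (act h (x_pt A)))))"
    using h by (rule SUP_upper)
  finally have "ereal (\<kappa> * ln s) / ereal (ln s)
      \<le> (SUP h\<in>h_ball s. ereal (ln (alpha1 (act h (x_pt A))))) / ereal (ln s)"
    using s by (intro ereal_divide_right_mono) auto
  then show "\<exists>s\<ge>N. ereal \<kappa>
      \<le> (SUP h\<in>h_ball s. ereal (ln (alpha1 (act h (x_pt A))))) / ereal (ln s)"
    using s by (intro exI[of _ s]) auto
qed

lemma gamma_x_pt:
  fixes A :: "real^'n::finite^'m::finite"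
  assumes irr: "\<And>v. v \<in> int_vecs \<Longrightarrow> v \<noteq> 0 \<Longrightarrow> 0 < err A v"
  shows "ereal (real CARD('n) / real (CARD('m) + CARD('n))) + gamma (x_pt A) = 1 - 1 / mu A"
proof -
  define e where "e = real CARD('n) / real (CARD('m) + CARD('n))"
  define \<alpha> where "\<alpha> t = alpha1 (act (g_flow t) (x_pt A))" for t
  have inv_mnorm: "1 / mnorm (g_flow t *v (lat A *v v)) =
      exp (- (e * t)) * (1 / max (err A v) (norm (p2 v) / exp t))" for t v
    unfolding mnorm_g_flow_lat e_def[symmetric] by (simp add: exp_minus field_simps)
  have \<alpha>_pos: "0 < \<alpha> t" for t
    unfolding \<alpha>_def by (intro alpha1_pos act_X_space g_flow_SL_R x_pt_in_X_space)
  \<comment> \<open>Substituting \<open>t = ln T\<close> gives both exponents the same form.\<close>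
  define f where "f T = ereal e + ereal (ln (\<alpha> (ln T)) / ln T)" for T
  have "ereal e + gamma (x_pt A) = Limsup at_top (\<lambda>t. f (exp t))"
    unfolding gamma_def f_def \<alpha>_def by (subst Limsup_add_ereal_left) auto
  also have "\<dots> = Limsup (filtermap exp at_top) f"
    by (rule Limsup_filtermap_eq[symmetric]) (simp add: inj_def)
  also have "\<dots> = Limsup at_top f" by (simp add: filtermap_exp_at_top)
  also have "\<dots> = 1 - 1 / mu A"
  proof (rule Limsup_log_quotient_eqI[where c = 0])
    show "0 \<le> 1 - 1 / mu A" by (rule one_minus_inverse_mu_bounds)
  next
    fix \<kappa> assume "1 - 1 / mu A < ereal \<kappa>"
    then obtain C where C: "0 < C" "\<And>v T. v \<in> int_vecs \<Longrightarrow> v \<noteq> 0 \<Longrightarrow> 1 \<le> T \<Longrightarrow>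
         1 / max (err A v) (norm (p2 v) / T) \<le> max C (T powr \<kappa>)"
      using mu_upper[OF irr] by blast
    have "f T \<le> ereal (ln (max C ((T + 0) powr \<kappa>)) / ln T)" if T: "2 \<le> T" for T
    proof -
      let ?K = "max C (T powr \<kappa>)"
      have "\<alpha> (ln T) \<le> exp (- (e * ln T)) * ?K"
        unfolding \<alpha>_def
      proof (rule alpha1_upper[OF g_flow_SL_R])
        fix v :: "real^('m + 'n)" assume "v \<in> prim_vecs"
        then show "1 / mnorm (g_flow (ln T) *v (lat A *v v)) \<le> exp (- (e * ln T)) * ?K"
          unfolding inv_mnorm
          using C(2)[of v T] T by (intro mult_left_mono) (auto simp: prim_vecs_imp_int_vecs prim_vecs_nonzero)
      qed
      then have "ln (\<alpha> (ln T)) \<le> ln (exp (- (e * ln T)) * ?K)"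
        using \<alpha>_pos by (intro ln_mono) auto
      also have "\<dots> = - (e * ln T) + ln ?K" using C(1) by (subst ln_mult) auto
      finally have "(e * ln T + ln (\<alpha> (ln T))) / ln T \<le> ln ?K / ln T"
        using T by (intro divide_right_mono) auto
      then show ?thesis using T by (simp add: f_def add_divide_distrib)
    qed
    then show "\<exists>C. \<forall>\<^sub>F T in at_top. f T \<le> ereal (ln (max C ((T + 0) powr \<kappa>)) / ln T)"
      by (auto intro!: exI[of _ C] eventually_at_top_linorderI[of 2])
  next
    fix \<kappa> N assume "ereal \<kappa> < 1 - 1 / mu A"
    then obtain v where v: "v \<in> prim_vecs" "max 2 N \<le> norm (p2 v) / err A v"
      "\<kappa> * ln (norm (p2 v) / err A v) \<le> ln (1 / err A v)"
      using mu_lower[OF irr, where N = "max 2 N"] by metis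
    define T where "T = norm (p2 v) / err A v"
    have a: "0 < err A v" using irr v prim_vecs_imp_int_vecs prim_vecs_nonzero by blast
    have T: "2 \<le> T" "N \<le> T" using v(2) by (auto simp: T_def)
    have "norm (p2 v) / T = err A v" using T a by (auto simp: T_def)
    then have "exp (- (e * ln T)) * (1 / err A v) \<le> \<alpha> (ln T)"
      using alpha1_lower[OF g_flow_SL_R v(1), of "ln T" A] T unfolding inv_mnorm \<alpha>_def by simp
    then have "ln (exp (- (e * ln T)) * (1 / err A v)) \<le> ln (\<alpha> (ln T))"
      using a by (intro ln_mono) auto
    moreover have "ln (exp (- (e * ln T)) * (1 / err A v)) = - (e * ln T) + ln (1 / err A v)"
      using a by (subst ln_mult) auto
    ultimately have "\<kappa> * ln T \<le> e * ln T + ln (\<alpha> (ln T))" using v(3) by (simp add: T_def)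
    then have "ereal \<kappa> \<le> f T" using T by (simp add: f_def field_simps)
    then show "\<exists>T\<ge>N. ereal \<kappa> \<le> f T" using T by blast
  qed
  finally show ?thesis by (simp add: e_def)
qed

theorem theorem2p3:
  fixes A :: "real^'n::finite^'m::finite"
  assumes "\<And>v :: real^('m + 'n). v \<in> int_vecs \<Longrightarrow> v \<noteq> 0 \<Longrightarrow> A *v p2 v \<noteq> p1 v"
  shows "beta (x_pt A) = ereal (real CARD('n) / real (CARD('m) + CARD('n))) + gamma (x_pt A) \<and>
         ereal (real CARD('n) / real (CARD('m) + CARD('n))) + gamma (x_pt A) = 1 - 1 / mu A"
proof -
  have "0 < err A v" if "v \<in> int_vecs" "v \<noteq> 0" for v
    using assms[OF that] by (simp add: err_def)
  from beta_x_pt[OF this] gamma_x_pt[OF this] show ?thesis by simp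
qed

end
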